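(* Let $P$ be a poset, let $\mathcal V$ be a minimal join-specification of $P$, let $\Phi=\Gamma_{\mathcal V}:\wp(P)\to\wp(P)$ be the associated closure operator, and let $\Upsilon:\wp(P)\to\wp(P)$ be the associated operator, both as defined in the context. The following are equivalent: (1) $\Phi(S)=\Upsilon(S)$ for all $S\in\wp(P)$. (2) $\Phi[\wp(P)]$, the set of $\Phi$-closed subsets of $P$ ordered by inclusion, is a frame.
   Context: For $S\subseteq P$, $S^\downarrow=\{p\in P: p\leq s\text{ for some }s\in S\}$ and $p^\downarrow=\{p\}^\downarrow$. A closure operator $\Gamma$ on $\wp(P)$ is an extensive, monotone, idempotent map $\wp(P)\to\wp(P)$; it is standard if $\Gamma(\{p\})=p^\downarrow$ for all $p\in P$. The $\Gamma$-closed sets form a complete lattice under inclusion, denoted $\Gamma[\wp(P)]$, with meet given by intersection and $\bigvee_I C_i=\Gamma(\bigcup_I C_i)$. A join-specification of $P$ is a set $\mathcal U\subseteq\wp(P)$ such that $\bigvee S$ exists in $P$ for all $S\in\mathcal U$, $\{p\}\in\mathcal U$ for all $p\in P$, and $\emptyset\notin\mathcal U$. The radius of $\mathcal U$ is the smallest cardinal $\sigma$ with $\sigma>|S|$ for all $S\in\mathcal U$. Given a join-specification $\mathcal U$ with radius $\sigma$, define for $S\subseteq P$ by transfinite recursion: $\Gamma_0(S)=S^\downarrow$; $\Gamma_{\alpha+1}(S)=\{\bigvee T: T\in\mathcal U,\ T\subseteq\Gamma_\alpha(S)\}^\downarrow$; $\Gamma_\lambda(S)=\bigcup_{\beta<\lambda}\Gamma_\beta(S)$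 for limit $\lambda$. Let $\Gamma_{\mathcal U}(S)=\Gamma_\chi(S)$, where $\chi$ is the smallest (infinite) regular cardinal with $\sigma\leq\chi$. $\Gamma_{\mathcal U}$ is a standard closure operator. $\mathcal U$ is minimal if the radius of $\mathcal U$ equals the minimum of the radii of all join-specifications $\mathcal U'$ of $P$ with $\Gamma_{\mathcal U'}=\Gamma_{\mathcal U}$. For a standard closure operator $\Gamma$, $\mathcal U_\Gamma$ is the set of $S\subseteq P$ such that $\bigvee S$ exists in $P$ and, for all $\Gamma$-closed sets $C$, $S\subseteq C$ implies $\bigvee S\in C$. With $\Phi=\Gamma_{\mathcal V}$, let $\sigma'$ be the radius of $\mathcal U_\Phi$ (the smallest cardinal strictly larger than $|S|$ for every $S\in\mathcal U_\Phi$) and let $\chi'$ be the smallest (infinite) regular cardinal with $\sigma'\leq\chi'$. For $S\subseteq P$ define: $\Upsilon_0(S)=S^\downarrow$; $\Upsilon_{\alpha+1}(S)=\{\bigvee T: T\in\mathcal U_\Phi,\ T\subseteq\Upsilon_\alpha(S)\}$ (no downward closure here); $\Upsilon_\lambda(S)=\bigcup_{\beta<\lambda}\Upsilon_\beta(S)$ for limit $\lambda$. Put $\Upsilon(S)=\Upsilon_{\chi'}(S)$. A lattice $L$ is $\alpha$-distributive (for a cardinal $\alpha$) if whenever $\{x\}\cup Y\subseteq L$, $|Y|<\alpha$ and $x\wedge\bigvee Y$ exists, then $\bigvee_{y\in Y}(x\wedge y)$ exists and equals $x\wedge\bigvee Y$. A frame is a complete lattice that is $\alpha$-distributive for all cardinals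 $\alpha$. *)

theory Defs
  imports "HOL-Algebra.Complete_Lattice"
begin

unbundle cardinal_syntax

section \<open>Radius and the associated regular cardinal\<close>

text \<open>
  Cardinals are represented, as in the BNF cardinal library, by well-orders \<open>r\<close> with
  \<open>Card_order r\<close>, finite ones included. For families of subsets of \<open>'a\<close> the type below has enough
  room for the radius and for the infinite regular cardinal above it, even when \<open>'a\<close> is finite;
  see \<open>is_radius_radius\<close> and \<open>is_reg_above_radius\<close>. Minimality among the cardinals of this type
  amounts to minimality among all cardinals; see \<open>radius_least\<close> and \<open>reg_above_radius_least\<close>.
\<close>

type_synonym 'a cardinal = "('a + nat) set rel"

definition is_radius :: "'a set set \<Rightarrow> 'a cardinal \<Rightarrow> bool" where
  "is_radius U \<sigma> \<longleftrightarrow>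
     Card_order \<sigma> \<and> (\<forall>S\<in>U. |S| <o \<sigma>) \<and>
     (\<forall>\<tau> :: 'a cardinal. Card_order \<tau> \<and> (\<forall>S\<in>U. |S| <o \<tau>) \<longrightarrow> \<sigma> \<le>o \<tau>)"

definition radius :: "'a set set \<Rightarrow> 'a cardinal" where
  "radius U = (SOME \<sigma>. is_radius U \<sigma>)"

definition is_reg_above :: "'a cardinal \<Rightarrow> 'a cardinal \<Rightarrow> bool" where
  "is_reg_above \<sigma> \<chi> \<longleftrightarrow>
     Cinfinite \<chi> \<and> regularCard \<chi> \<and> \<sigma> \<le>o \<chi> \<and>
     (\<forall>\<tau> :: 'a cardinal. Cinfinite \<tau> \<and> regularCard \<tau> \<and> \<sigma> \<le>o \<tau> \<longrightarrow> \<chi> \<le>o \<tau>)"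

definition reg_above :: "'a cardinal \<Rightarrow> 'a cardinal" where
  "reg_above \<sigma> = (SOME \<chi>. is_reg_above \<sigma> \<chi>)"

lemma ex_ordLeq_least:
  fixes Q :: "'b rel \<Rightarrow> bool"
  assumes "Q r" and "\<And>r. Q r \<Longrightarrow> Card_order r"
  shows "\<exists>s. Q s \<and> (\<forall>t. Q t \<longrightarrow> s \<le>o t)"
proof -
  have "\<exists>s\<in>Collect Q. \<forall>t\<in>Collect Q. s \<le>o t"
    by (rule exists_minim_Well_order) (use assms in \<open>auto simp: card_order_on_def\<close>)
  then show ?thesis by auto
qed

lemma ordLess_imp_copy:
  fixes t :: "'b rel" and r :: "'c rel"
  assumes "Card_order t" "Card_order r" "t <o r"
  obtains t' :: "'c rel" where "Card_order t'" "t' =o t"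
proof -
  have "|Field t| \<le>o |Field r|"
    using assms(3) card_of_mono2 ordLess_imp_ordLeq by blast
  then obtain f where f: "inj_on f (Field t)" "f ` Field t \<subseteq> Field r"
    by (auto simp: card_of_ordLeq[symmetric])
  have "|Field t| =o |f ` Field t|"
    using f(1) by (meson card_of_ordIsoI inj_on_imp_bij_betw)
  then have "|f ` Field t| =o t"
    using assms(1) card_of_Field_ordIso ordIso_transitive ordIso_symmetric by blast
  with that[of "|f ` Field t|"] card_of_Card_order show thesis by blast
qed

lemma card_of_less_cardSuc:
  fixes S :: "'a set"
  shows "|S| <o cardSuc |UNIV :: ('a + nat) set|"
proof -
  have "|S| =o |Inl ` S :: ('a + nat) set|"
    by (rule card_of_ordIsoI[of Inl]) (simp add: bij_betw_def)
  moreover have "|Inl ` S :: ('a + nat) set| \<le>o |UNIV :: ('a + nat) set|"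
    by (rule card_of_mono1) simp
  ultimately have "|S| \<le>o |UNIV :: ('a + nat) set|"
    using ordIso_ordLeq_trans by blast
  then show ?thesis
    using cardSuc_greater[OF card_of_Card_order] ordLeq_ordLess_trans by blast
qed

lemma is_radius_radius: "is_radius U (radius U)"
proof -
  let ?Q = "\<lambda>\<sigma> :: 'a cardinal. Card_order \<sigma> \<and> (\<forall>S\<in>U. |S| <o \<sigma>)"
  have "\<exists>\<sigma>. ?Q \<sigma> \<and> (\<forall>\<tau>. ?Q \<tau> \<longrightarrow> \<sigma> \<le>o \<tau>)"
    by (rule ex_ordLeq_least[of ?Q "cardSuc |UNIV :: ('a + nat) set|"])
      (use card_of_less_cardSuc cardSuc_Card_order[OF card_of_Card_order] in blast)+
  then have "\<exists>\<sigma>. is_radius U \<sigma>"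
    unfolding is_radius_def by blast
  then show ?thesis
    unfolding radius_def by (rule someI_ex)
qed

lemma radius_least:
  fixes \<tau> :: "'b rel"
  assumes "Card_order \<tau>" "\<forall>S\<in>U. |S| <o \<tau>"
  shows "radius U \<le>o \<tau>"
proof (rule ccontr)
  have r: "Card_order (radius U)"
    using is_radius_radius is_radius_def by blast
  assume "\<not> radius U \<le>o \<tau>"
  then have less: "\<tau> <o radius U"
    using r assms(1) by (simp add: card_order_on_well_order_on not_ordLeq_iff_ordLess)
  then obtain \<tau>' :: "'a cardinal" where t: "Card_order \<tau>'" "\<tau>' =o \<tau>"
    using ordLess_imp_copy[OF assms(1) r] by blast
  have "\<forall>S\<in>U. |S| <o \<tau>'"
    using assms(2) t(2) ordLess_ordIso_trans ordIso_symmetric by blast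
  then have "radius U \<le>o \<tau>'"
    using is_radius_radius[of U] t(1) unfolding is_radius_def by blast
  then have "radius U \<le>o \<tau>"
    using t(2) ordLeq_ordIso_trans by blast
  with less show False
    using not_ordLess_ordLeq by blast
qed

lemma is_reg_above_radius: "is_reg_above (radius U) (reg_above (radius U))"
proof -
  let ?k = "cardSuc |UNIV :: ('a + nat) set|"
  let ?Q = "\<lambda>\<chi> :: 'a cardinal. Cinfinite \<chi> \<and> regularCard \<chi> \<and> radius U \<le>o \<chi>"
  have inf: "Cinfinite |UNIV :: ('a + nat) set|"
    by (simp add: cinfinite_def card_of_card_order_on Field_card_of)
  have "\<exists>\<chi>. ?Q \<chi> \<and> (\<forall>\<tau>. ?Q \<tau> \<longrightarrow> \<chi> \<le>o \<tau>)"
  proof (rule ex_ordLeq_least[of ?Q ?k])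
    show "?Q ?k"
      using Cinfinite_cardSuc[OF inf] regularCard_cardSuc[OF inf]
      by (simp add: radius_least card_of_less_cardSuc cardSuc_Card_order)
  qed auto
  then have "\<exists>\<chi>. is_reg_above (radius U) \<chi>"
    unfolding is_reg_above_def by blast
  then show ?thesis
    unfolding reg_above_def by (rule someI_ex)
qed

lemma reg_above_radius_least:
  fixes \<tau> :: "'b rel"
  assumes "Cinfinite \<tau>" "regularCard \<tau>" "radius U \<le>o \<tau>"
  shows "reg_above (radius U) \<le>o \<tau>"
proof (rule ccontr)
  let ?c = "reg_above (radius U)"
  have r: "Card_order ?c"
    using is_reg_above_radius is_reg_above_def by blast
  assume "\<not> ?c \<le>o \<tau>"
  then have less: "\<tau> <o ?c"
    using r assms(1) by (simp add: card_order_on_well_order_on not_ordLeq_iff_ordLess)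
  then obtain \<tau>' :: "'a cardinal" where t: "Card_order \<tau>'" "\<tau>' =o \<tau>"
    using ordLess_imp_copy[of \<tau> ?c] assms(1) r by blast
  have "Cinfinite \<tau>'" "regularCard \<tau>'" "radius U \<le>o \<tau>'"
    using assms t Cinfinite_cong regularCard_ordIso ordIso_symmetric ordLeq_ordIso_trans
    by blast+
  then have "?c \<le>o \<tau>'"
    using is_reg_above_radius[of U] unfolding is_reg_above_def by blast
  then have "?c \<le>o \<tau>"
    using t(2) ordLeq_ordIso_trans by blast
  with less show False
    using not_ordLess_ordLeq by blast
qed


section \<open>Transfinite iteration\<close>

text \<open>
  An ordinal below \<open>r\<close> is represented by the element \<open>i\<close> of \<open>Field r\<close> at that position; \<open>i\<close> is the
  successor of \<open>j\<close> when the strict predecessors of \<open>i\<close> are exactly the elements up to \<open>j\<close>.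
\<close>

definition iter_stage :: "('b set \<Rightarrow> 'b set) \<Rightarrow> 'b set \<Rightarrow> 'i rel \<Rightarrow> 'i \<Rightarrow> 'b set" where
  "iter_stage F A r = wo_rel.worec r (\<lambda>g i.
     if underS r i = {} then A
     else if \<exists>j\<in>underS r i. underS r i = under r j
       then F (g (THE j. j \<in> underS r i \<and> underS r i = under r j))
     else (\<Union>j\<in>underS r i. g j))"

text \<open>The stage at the limit ordinal \<open>r\<close> itself.\<close>

definition iter_upto :: "('b set \<Rightarrow> 'b set) \<Rightarrow> 'b set \<Rightarrow> 'i rel \<Rightarrow> 'b set" where
  "iter_upto F A r = (\<Union>i\<in>Field r. iter_stage F A r i)"

lemma succ_unique:
  assumes "Well_order r" "j \<in> underS r i" "underS r i = under r j"
    and "k \<in> underS r i" "underS r i = under r k"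
  shows "k = j"
proof -
  have "(j, k) \<in> r" "(k, j) \<in> r"
    using assms(2-) by (auto simp: under_def)
  then show ?thesis
    using assms(1) wo_rel.ANTISYM[of r] by (auto simp: wo_rel_def antisym_def)
qed

lemma iter_stage_unfold:
  assumes "Well_order r"
  shows "iter_stage F A r i =
    (if underS r i = {} then A
     else if \<exists>j\<in>underS r i. underS r i = under r j
       then F (iter_stage F A r (THE j. j \<in> underS r i \<and> underS r i = under r j))
     else (\<Union>j\<in>underS r i. iter_stage F A r j))"
proof -
  interpret wo_rel r by unfold_locales (rule assms)
  let ?H = "\<lambda>g i. if underS i = {} then A
     else if \<exists>j\<in>underS i. underS i = under j
       then F (g (THE j. j \<in> underS i \<and> underS i = under j))
     else (\<Union>j\<in>underS i. g j)"
  have "adm_wo ?H"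
    unfolding adm_wo_def
  proof (intro allI impI)
    fix f g :: "'a \<Rightarrow> 'b set" and x
    assume eq: "\<forall>y\<in>underS x. f y = g y"
    have "(THE j. j \<in> underS x \<and> underS x = under j) \<in> underS x"
      if "\<exists>j\<in>underS x. underS x = under j"
    proof -
      from that obtain j where j: "j \<in> underS x" "underS x = under j" ..
      then have "(THE j. j \<in> underS x \<and> underS x = under j) = j"
        by (intro the_equality conjI) (use succ_unique[OF assms] in blast)+
      with j(1) show ?thesis by simp
    qed
    with eq show "?H f x = ?H g x" by auto
  qed
  from worec_fixpoint[OF this] show ?thesis
    unfolding iter_stage_def by (rule fun_cong)
qed

lemma iter_stage_zero:
  assumes "Well_order r" "underS r i = {}"
  shows "iter_stage F A r i = A"
  by (subst iter_stage_unfold[OF assms(1)]) (simp add: assms(2))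

lemma iter_stage_succ:
  assumes "Well_order r" "j \<in> underS r i" "underS r i = under r j"
  shows "iter_stage F A r i = F (iter_stage F A r j)"
proof -
  have "(THE j. j \<in> underS r i \<and> underS r i = under r j) = j"
    by (intro the_equality conjI) (use assms succ_unique[OF assms(1)] in blast)+
  then show ?thesis
    by (subst iter_stage_unfold[OF assms(1)]) (use assms(2,3) in auto)
qed

lemma iter_stage_limit:
  assumes "Well_order r" "underS r i \<noteq> {}"
    and "\<And>j. j \<in> underS r i \<Longrightarrow> underS r i \<noteq> under r j"
  shows "iter_stage F A r i = (\<Union>j\<in>underS r i. iter_stage F A r j)"
  by (subst iter_stage_unfold[OF assms(1)]) (use assms(2,3) in auto)


section \<open>Join-specifications and closure operators\<close>

definition down_closure :: "('a, 'm) gorder_scheme \<Rightarrow> 'a set \<Rightarrow> 'a set" where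
  "down_closure P S = {p \<in> carrier P. \<exists>s\<in>S. p \<sqsubseteq>\<^bsub>P\<^esub> s}"

definition join_exists :: "('a, 'm) gorder_scheme \<Rightarrow> 'a set \<Rightarrow> bool" where
  "join_exists P S \<longleftrightarrow> (\<exists>s. is_lub P s S)"

definition join_specification :: "('a, 'm) gorder_scheme \<Rightarrow> 'a set set \<Rightarrow> bool" where
  "join_specification P U \<longleftrightarrow>
     U \<subseteq> Pow (carrier P) \<and> (\<forall>S\<in>U. join_exists P S) \<and> (\<forall>p\<in>carrier P. {p} \<in> U) \<and> {} \<notin> U"

definition spec_joins :: "('a, 'm) gorder_scheme \<Rightarrow> 'a set set \<Rightarrow> 'a set \<Rightarrow> 'a set" where
  "spec_joins P U S = {\<Squnion>\<^bsub>P\<^esub>T | T. T \<in> U \<and> T \<subseteq> S}"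

text \<open>The operator \<open>\<Gamma>\<^sub>U\<close>.\<close>

definition spec_closure :: "('a, 'm) gorder_scheme \<Rightarrow> 'a set set \<Rightarrow> 'a set \<Rightarrow> 'a set" where
  "spec_closure P U S =
     iter_upto (\<lambda>X. down_closure P (spec_joins P U X)) (down_closure P S) (reg_above (radius U))"

text \<open>The radius of \<open>U\<close> always belongs to the radii competing for the minimum.\<close>

definition minimal_join_specification :: "('a, 'm) gorder_scheme \<Rightarrow> 'a set set \<Rightarrow> bool" where
  "minimal_join_specification P U \<longleftrightarrow>
     join_specification P U \<and>
     (\<forall>U'. join_specification P U' \<and>
        (\<forall>S\<in>Pow (carrier P). spec_closure P U' S = spec_closure P U S)
        \<longrightarrow> radius U \<le>o radius U')"

definition closed_sets :: "('a, 'm) gorder_scheme \<Rightarrow> ('a set \<Rightarrow> 'a set) \<Rightarrow> 'a set set" where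
  "closed_sets P \<Gamma> = {C \<in> Pow (carrier P). \<Gamma> C = C}"

definition closed_order :: "('a, 'm) gorder_scheme \<Rightarrow> ('a set \<Rightarrow> 'a set) \<Rightarrow> 'a set gorder" where
  "closed_order P \<Gamma> = \<lparr>carrier = closed_sets P \<Gamma>, eq = (=), le = (\<subseteq>)\<rparr>"

text \<open>The family \<open>U\<^sub>\<Gamma>\<close> of a standard closure operator \<open>\<Gamma>\<close>.\<close>

definition closure_spec :: "('a, 'm) gorder_scheme \<Rightarrow> ('a set \<Rightarrow> 'a set) \<Rightarrow> 'a set set" where
  "closure_spec P \<Gamma> =
     {S \<in> Pow (carrier P). join_exists P S \<and> (\<forall>C\<in>closed_sets P \<Gamma>. S \<subseteq> C \<longrightarrow> \<Squnion>\<^bsub>P\<^esub>S \<in> C)}"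

text \<open>The operator \<open>\<Upsilon>\<close> associated with \<open>\<Phi>\<close>; only stage \<open>0\<close> takes a downward closure.\<close>

definition join_iteration :: "('a, 'm) gorder_scheme \<Rightarrow> ('a set \<Rightarrow> 'a set) \<Rightarrow> 'a set \<Rightarrow> 'a set" where
  "join_iteration P \<Phi> S =
     iter_upto (spec_joins P (closure_spec P \<Phi>)) (down_closure P S)
       (reg_above (radius (closure_spec P \<Phi>)))"


section \<open>Distributive lattices and frames\<close>

definition alpha_distributive :: "('b, 'm) gorder_scheme \<Rightarrow> 'i rel \<Rightarrow> bool" where
  "alpha_distributive L \<alpha> \<longleftrightarrow>
     lattice L \<and>
     (\<forall>x\<in>carrier L. \<forall>Y\<subseteq>carrier L. |Y| <o \<alpha> \<and> join_exists L Y \<longrightarrow>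
        is_lub L (x \<sqinter>\<^bsub>L\<^esub> \<Squnion>\<^bsub>L\<^esub>Y) ((\<lambda>y. x \<sqinter>\<^bsub>L\<^esub> y) ` Y))"

text \<open>
  A definition cannot quantify over the types carrying cardinals. The type \<open>'b set\<close> carries cardinals
  above that of every \<open>Y\<close>, so nothing is lost; see \<open>frame_alpha_distributive\<close>.
\<close>

definition frame :: "('b, 'm) gorder_scheme \<Rightarrow> bool" where
  "frame L \<longleftrightarrow>
     complete_lattice L \<and> (\<forall>\<alpha> :: 'b set rel. Card_order \<alpha> \<longrightarrow> alpha_distributive L \<alpha>)"

lemma frame_alpha_distributive:
  fixes \<alpha> :: "'i rel"
  assumes "frame L"
  shows "alpha_distributive L \<alpha>"
proof -
  let ?k = "cardSuc |UNIV :: 'a set|"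
  have L: "alpha_distributive L ?k"
    using assms cardSuc_Card_order[OF card_of_Card_order] unfolding frame_def by blast
  have "|Y| <o ?k" for Y :: "'a set"
    using card_of_mono1[OF subset_UNIV] cardSuc_greater[OF card_of_Card_order]
      ordLeq_ordLess_trans by blast
  with L show ?thesis
    unfolding alpha_distributive_def by blast
qed

end

theory Submission
  imports Defs
begin

text \<open>
  Write \<open>\<down>p\<close> for the principal down-set of \<open>p\<close>. The closed sets of \<open>\<Phi>\<close> are the down-sets that
  contain the join of each of their subsets in \<open>V\<close>; regularity of the cardinal that bounds the
  iteration is what makes \<open>\<Phi> S\<close> the least of them above \<open>S\<close> (\<open>join_ideal_spec_closure\<close>).
  In the lattice of closed sets, meets are intersections and the join of a family is \<open>\<Phi>\<close> of its
  union, so the frame law is the inclusion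
  \<open>C \<inter> \<Phi> (\<Union>Y) \<subseteq> \<Phi> (\<Union>D\<in>Y. C \<inter> D)\<close> (\<open>closure_on.frame_iff\<close>).

  Suppose the lattice is a frame and let \<open>p \<in> \<Phi> S\<close>. Intersecting \<open>\<down>p\<close> with \<open>\<Phi> S\<close>, which is the join
  of the sets \<open>\<down>s\<close> for \<open>s \<in> S\<close>, shows that the set \<open>T\<close> of all points below both \<open>p\<close> and some element
  of \<open>S\<close> satisfies \<open>p \<in> \<Phi> T\<close>. Every \<open>\<down>q\<close> is closed, so every upper bound \<open>q\<close> of \<open>T\<close> lies above \<open>p\<close>;
  hence \<open>p\<close> is the join of \<open>T\<close>, and this join belongs to every closed set that includes \<open>T\<close>
  (\<open>join_of_generating_set\<close>). As \<open>T\<close> is part of stage \<open>0\<close> of \<open>\<Upsilon>\<close>, the point \<open>p\<close> already appears at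
  stage \<open>1\<close>.

  Conversely, the stages of \<open>\<Upsilon>\<close> are built by taking joins only, and this is what lets an
  intersection with a down-set pass through them: if a join lies in a closed \<open>C\<close>, so do all the
  elements that it joins. By induction on the stages, the points of \<open>\<Upsilon> A\<close> in \<open>C\<close> are generated by the
  points of the down-set of \<open>A\<close> in \<open>C\<close> (\<open>join_iteration_Int_ideal_subset\<close>). When \<open>\<Upsilon> = \<Phi>\<close>, taking \<open>A\<close> to
  be a union of closed sets gives the frame law.
\<close>

section \<open>Transfinite iteration along an infinite cardinal\<close>

lemma iter_stage_induct:
  assumes r: "Well_order r" and "Q A" and F: "\<And>X. Q X \<Longrightarrow> Q (F X)"
    and Un: "\<And>\<X>. \<X> \<noteq> {} \<Longrightarrow> (\<And>X. X \<in> \<X> \<Longrightarrow> Q X) \<Longrightarrow> Q (\<Union>\<X>)"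
  shows "Q (iter_stage F A r i)"
proof -
  interpret wo_rel r by unfold_locales (rule r)
  show ?thesis
  proof (induction i rule: well_order_induct)
    case (1 i)
    then have IH: "Q (iter_stage F A r j)" if "j \<in> underS i" for j
      using that by (auto simp: underS_def)
    consider "underS i = {}" | j where "j \<in> underS i" "underS i = under j"
      | "underS i \<noteq> {}" "\<And>j. j \<in> underS i \<Longrightarrow> underS i \<noteq> under j"
      by blast
    then show ?case
    proof cases
      case 1
      then show ?thesis
        by (simp add: iter_stage_zero[OF r] \<open>Q A\<close>)
    next
      case 2
      then show ?thesis
        by (simp add: iter_stage_succ[OF r] IH F)
    next
      case 3
      then show ?thesis
        by (subst iter_stage_limit[OF r]) (auto intro!: Un IH)
    qed
  qed
qed

lemma iter_upto_induct:
  assumes r: "Cinfinite r" and "Q A" and "\<And>X. Q X \<Longrightarrow> Q (F X)"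
    and Un: "\<And>\<X>. \<X> \<noteq> {} \<Longrightarrow> (\<And>X. X \<in> \<X> \<Longrightarrow> Q X) \<Longrightarrow> Q (\<Union>\<X>)"
  shows "Q (iter_upto F A r)"
proof -
  have "Field r \<noteq> {}"
    using r by (auto simp: cinfinite_def)
  moreover have "Q (iter_stage F A r i)" for i
    by (rule iter_stage_induct) (use assms in \<open>auto intro: Card_order_wo_rel[unfolded wo_rel_def]\<close>)
  ultimately show ?thesis
    unfolding iter_upto_def by (intro Un) auto
qed

lemma Cinfinite_successor:
  assumes r: "Cinfinite r" and j: "j \<in> Field r"
  obtains i where "i \<in> Field r" "j \<in> underS r i" "underS r i = under r j"
proof -
  interpret wo_rel r using r by (simp add: Card_order_wo_rel)
  have "AboveS {j} \<noteq> {}"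
    using infinite_Card_order_limit[of r j] r j by (auto simp: cinfinite_def AboveS_def)
  then have suc: "j \<in> underS (suc {j})" "suc {j} \<in> Field r"
    using suc_greater[of "{j}" j] suc_inField[of "{j}"] j by (auto simp: underS_def)
  have "underS (suc {j}) = under j"
  proof
    show "underS (suc {j}) \<subseteq> under j"
    proof
      fix k assume k: "k \<in> underS (suc {j})"
      show "k \<in> under j"
      proof (rule ccontr)
        assume "k \<notin> under j"
        moreover have "k \<in> Field r"
          using k by (auto simp: underS_def Field_def)
        ultimately have "k \<in> AboveS {j}"
          using TOTALS REFL j by (auto simp: under_def AboveS_def refl_on_def)
        then have "(suc {j}, k) \<in> r"
          by (rule suc_least_AboveS)
        with k show False
          using ANTISYM by (auto simp: underS_def antisym_def)
      qed
    qed
    show "under j \<subseteq> underS (suc {j})"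
    proof
      fix k assume "k \<in> under j"
      then have kj: "(k, j) \<in> r" by (simp add: under_def)
      have js: "(j, suc {j}) \<in> r" "j \<noteq> suc {j}"
        using suc(1) by (auto simp: underS_def)
      have "(k, suc {j}) \<in> r"
        using transD[OF TRANS kj js(1)] .
      moreover have "k \<noteq> suc {j}"
        using antisymD[OF ANTISYM js(1)] kj js(2) by blast
      ultimately show "k \<in> underS (suc {j})"
        by (simp add: underS_def)
    qed
  qed
  with suc that show thesis by blast
qed

lemma Cinfinite_least:
  assumes r: "Cinfinite r"
  obtains z where "z \<in> Field r" "underS r z = {}"
proof -
  interpret wo_rel r using r by (simp add: Card_order_wo_rel)
  have "Field r \<noteq> {}"
    using r by (auto simp: cinfinite_def)
  then have "minim (Field r) \<in> Field r"
    by (intro minim_in) auto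
  moreover have "underS (minim (Field r)) = {}"
  proof (rule ccontr)
    assume "underS (minim (Field r)) \<noteq> {}"
    then obtain k where k: "(k, minim (Field r)) \<in> r" "k \<noteq> minim (Field r)"
      by (auto simp: underS_def)
    then have "(minim (Field r), k) \<in> r"
      by (intro minim_least) (auto intro: FieldI1)
    with k show False
      using antisymD[OF ANTISYM] by blast
  qed
  ultimately show thesis
    using that by blast
qed

lemma base_subset_iter_upto:
  assumes r: "Cinfinite r"
  shows "A \<subseteq> iter_upto F A r"
proof -
  obtain z where z: "z \<in> Field r" "underS r z = {}"
    using Cinfinite_least[OF r] .
  have "iter_stage F A r z = A"
    using r z(2) by (simp add: iter_stage_zero card_order_on_well_order_on)
  with z(1) show ?thesis
    unfolding iter_upto_def by blast
qed

lemma step_base_subset_iter_upto: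
  assumes r: "Cinfinite r"
  shows "F A \<subseteq> iter_upto F A r"
proof -
  have wo: "Well_order r"
    using r by (simp add: card_order_on_well_order_on)
  obtain z where z: "z \<in> Field r" "underS r z = {}"
    using Cinfinite_least[OF r] .
  obtain i where i: "i \<in> Field r" "z \<in> underS r i" "underS r i = under r z"
    using Cinfinite_successor[OF r z(1)] .
  have "iter_stage F A r i = F A"
    by (simp add: iter_stage_succ[OF wo i(2,3)] iter_stage_zero[OF wo z(2)])
  with i(1) show ?thesis
    unfolding iter_upto_def by blast
qed

text \<open>
  The invariant \<open>Q\<close> is there because \<open>F\<close> need only be extensive on the sets that the iteration meets,
  not on all sets.
\<close>

lemma iter_stage_chain:
  assumes r: "Well_order r" and "Q A" and F: "\<And>X. Q X \<Longrightarrow> Q (F X)"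
    and Un: "\<And>\<X>. \<X> \<noteq> {} \<Longrightarrow> (\<And>X. X \<in> \<X> \<Longrightarrow> Q X) \<Longrightarrow> Q (\<Union>\<X>)"
    and ext: "\<And>X. Q X \<Longrightarrow> X \<subseteq> F X"
  shows "relChain r (iter_stage F A r)"
proof -
  interpret wo_rel r by unfold_locales (rule r)
  have Q: "Q (iter_stage F A r i)" for i
    by (rule iter_stage_induct) (use assms in auto)
  have "\<forall>j. (j, i) \<in> r \<longrightarrow> iter_stage F A r j \<subseteq> iter_stage F A r i" for i
  proof (induction i rule: well_order_induct)
    case (1 i)
    show ?case
    proof (intro allI impI)
      fix j assume ji: "(j, i) \<in> r"
      show "iter_stage F A r j \<subseteq> iter_stage F A r i"
      proof (cases "j = i")
        case False
        with ji have j: "j \<in> underS i"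
          by (simp add: underS_def)
        show ?thesis
        proof (cases "\<exists>k\<in>underS i. underS i = under k")
          case True
          then obtain k where k: "k \<in> underS i" "underS i = under k" by blast
          with j have "iter_stage F A r j \<subseteq> iter_stage F A r k"
            using 1 by (auto simp: under_def underS_def)
          also have "\<dots> \<subseteq> F (iter_stage F A r k)"
            by (rule ext[OF Q])
          also have "\<dots> = iter_stage F A r i"
            by (simp add: iter_stage_succ[OF r k])
          finally show ?thesis .
        next
          case no_succ: False
          with j show ?thesis
            by (subst (2) iter_stage_limit[OF r]) auto
        qed
      qed simp
    qed
  qed
  then show ?thesis
    by (simp add: relChain_def)
qed

text \<open>
  A set smaller than a regular cardinal that lies in the limit of a chain of that length already lies
  in one of its stages, so one further step captures everything that \<open>F\<close> builds from the set.
\<close>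

lemma iter_upto_absorbs:
  assumes r: "Cinfinite r" "regularCard r" and "Q A" and "\<And>X. Q X \<Longrightarrow> Q (F X)"
    and "\<And>\<X>. \<X> \<noteq> {} \<Longrightarrow> (\<And>X. X \<in> \<X> \<Longrightarrow> Q X) \<Longrightarrow> Q (\<Union>\<X>)"
    and "\<And>X. Q X \<Longrightarrow> X \<subseteq> F X"
    and T: "|T| <o r" "T \<subseteq> iter_upto F A r"
  obtains X where "T \<subseteq> X" "F X \<subseteq> iter_upto F A r"
proof -
  interpret wo_rel r using r by (simp add: Card_order_wo_rel)
  have "relChain r (iter_stage F A r)"
    by (rule iter_stage_chain[of r Q]) (use assms WELL in auto)
  then obtain j where j: "j \<in> Field r" "T \<subseteq> iter_stage F A r j"
    using regularCard_UNION[of r "iter_stage F A r" T] r T unfolding iter_upto_def by blast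
  obtain i where i: "i \<in> Field r" "j \<in> underS i" "underS i = under j"
    using Cinfinite_successor[OF r(1) j(1)] .
  then have "F (iter_stage F A r j) \<subseteq> iter_upto F A r"
    using iter_stage_succ[OF WELL i(2,3), of F A] unfolding iter_upto_def by blast
  with j(2) that show thesis by blast
qed


section \<open>The closure operator of a join-specification\<close>

lemma Cinfinite_reg_above_radius: "Cinfinite (reg_above (radius U))"
  using is_reg_above_radius[of U] by (simp add: is_reg_above_def)

lemma join_exists_is_lub:
  assumes "join_exists P S"
  shows "is_lub P (\<Squnion>\<^bsub>P\<^esub>S) S"
  using assms unfolding join_exists_def sup_def by (rule someI_ex)

lemma (in partial_order) is_lub_imp_sup_eq:
  assumes "is_lub L s S"
  shows "\<Squnion>S = s"
  using assms join_exists_is_lub[of L S] least_unique unfolding join_exists_def by blast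

text \<open>
  The intrinsic description of the closed sets of \<open>spec_closure P U\<close>, free of transfinite iteration;
  \<open>closed_sets_spec_closure\<close> shows that it is correct.
\<close>

definition join_ideal :: "('a, 'm) gorder_scheme \<Rightarrow> 'a set set \<Rightarrow> 'a set \<Rightarrow> bool" where
  "join_ideal P U C \<longleftrightarrow>
     C \<subseteq> carrier P \<and> down_closure P C \<subseteq> C \<and> spec_joins P U C \<subseteq> C"

lemma spec_closure_subset_ideal:
  assumes "join_ideal P U C" "S \<subseteq> C"
  shows "spec_closure P U S \<subseteq> C"
  unfolding spec_closure_def
proof (rule iter_upto_induct[where Q = "\<lambda>X. X \<subseteq> C"])
  show "Cinfinite (reg_above (radius U))"
    by (rule Cinfinite_reg_above_radius)
  show "down_closure P S \<subseteq> C"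
    using assms by (auto simp: join_ideal_def down_closure_def)
  show "down_closure P (spec_joins P U X) \<subseteq> C" if "X \<subseteq> C" for X
  proof -
    have "spec_joins P U X \<subseteq> spec_joins P U C"
      using that by (auto simp: spec_joins_def)
    also have "\<dots> \<subseteq> C"
      using assms(1) by (simp add: join_ideal_def)
    finally show ?thesis
      using assms(1) by (auto simp: join_ideal_def down_closure_def)
  qed
qed blast

lemma (in partial_order) down_closure_idem:
  "down_closure L (down_closure L S) \<subseteq> down_closure L S" if "S \<subseteq> carrier L"
proof
  fix p assume "p \<in> down_closure L (down_closure L S)"
  then obtain q s where "p \<in> carrier L" "q \<in> carrier L" "s \<in> S" "p \<sqsubseteq> q" "q \<sqsubseteq> s"
    by (auto simp: down_closure_def)
  moreover have "s \<in> carrier L"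
    using that \<open>s \<in> S\<close> by blast
  ultimately show "p \<in> down_closure L S"
    using le_trans unfolding down_closure_def by blast
qed

lemma (in partial_order) subset_down_closure:
  "S \<subseteq> down_closure L S" if "S \<subseteq> carrier L"
  using that le_refl unfolding down_closure_def by blast

lemma (in partial_order) spec_joins_subset_carrier:
  assumes "join_specification L U"
  shows "spec_joins L U X \<subseteq> carrier L"
proof
  fix p assume "p \<in> spec_joins L U X"
  then obtain T where "T \<in> U" "p = \<Squnion>T"
    by (auto simp: spec_joins_def)
  then have "is_lub L p T"
    using assms join_exists_is_lub[of L T] by (simp add: join_specification_def)
  then show "p \<in> carrier L"
    by (rule least_closed)
qed

lemma (in partial_order) subset_spec_joins:
  assumes "join_specification L U" "X \<subseteq> carrier L"
  shows "X \<subseteq> spec_joins L U X"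
proof
  fix x assume x: "x \<in> X"
  with assms(2) have xL: "x \<in> carrier L" by blast
  then have "{x} \<in> U"
    using assms(1) unfolding join_specification_def by blast
  moreover have "\<Squnion>{x} = x"
    by (rule sup_of_singleton[OF xL])
  ultimately show "x \<in> spec_joins L U X"
    unfolding spec_joins_def by (intro CollectI exI[of _ "{x}"]) (simp add: x)
qed

text \<open>
  A set in \<open>U\<close> has fewer elements than the regular length of the iteration, so when the result
  includes it, some stage does already, and the next stage contains its join.
\<close>

lemma (in partial_order) join_ideal_spec_closure:
  assumes U: "join_specification L U" and S: "S \<subseteq> carrier L"
  shows "join_ideal L U (spec_closure L U S)"
proof -
  let ?F = "\<lambda>X. down_closure L (spec_joins L U X)" and ?r = "reg_above (radius U)"
  let ?Q = "\<lambda>X. X \<subseteq> carrier L \<and> down_closure L X \<subseteq> X"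
  have r: "Cinfinite ?r" "regularCard ?r" "radius U \<le>o ?r"
    using is_reg_above_radius[of U] by (auto simp: is_reg_above_def)
  have down: "?Q (down_closure L X)" if "X \<subseteq> carrier L" for X
    using down_closure_idem[OF that] unfolding down_closure_def by blast
  have Q0: "?Q (down_closure L S)"
    by (rule down[OF S])
  have QF: "?Q (?F X)" for X
    by (rule down[OF spec_joins_subset_carrier[OF U]])
  have QU: "?Q (\<Union>\<X>)" if "\<And>X. X \<in> \<X> \<Longrightarrow> ?Q X" for \<X>
  proof
    show "\<Union>\<X> \<subseteq> carrier L"
      using that by blast
    have "down_closure L (\<Union>\<X>) = (\<Union>X\<in>\<X>. down_closure L X)"
      by (auto simp: down_closure_def)
    with that show "down_closure L (\<Union>\<X>) \<subseteq> \<Union>\<X>"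
      by blast
  qed
  \<comment> \<open>The singletons in \<open>U\<close> put the elements of \<open>X\<close> among the joins of the step.\<close>
  have ext: "X \<subseteq> ?F X" if "?Q X" for X
  proof -
    have "X \<subseteq> spec_joins L U X"
      using that by (intro subset_spec_joins[OF U]) simp
    also have "\<dots> \<subseteq> ?F X"
      by (rule subset_down_closure[OF spec_joins_subset_carrier[OF U]])
    finally show ?thesis .
  qed
  have "\<Squnion>T \<in> spec_closure L U S" if T: "T \<in> U" "T \<subseteq> spec_closure L U S" for T
  proof -
    have "|T| <o radius U"
      using T(1) is_radius_radius[of U] by (auto simp: is_radius_def)
    then have small: "|T| <o ?r"
      using r(3) by (rule ordLess_ordLeq_trans)
    have "T \<subseteq> iter_upto ?F (down_closure L S) ?r"
      using T(2) by (simp add: spec_closure_def)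
    with r(1,2) Q0 QF QU ext small
    obtain X where X: "T \<subseteq> X" "?F X \<subseteq> iter_upto ?F (down_closure L S) ?r"
      by (rule iter_upto_absorbs[where Q = ?Q])
    have "\<Squnion>T \<in> spec_joins L U X"
      using X(1) T(1) unfolding spec_joins_def by blast
    then have "\<Squnion>T \<in> ?F X"
      by (rule subsetD[OF subset_down_closure[OF spec_joins_subset_carrier[OF U]]])
    with X(2) show ?thesis
      unfolding spec_closure_def by (rule subsetD)
  qed
  then have "spec_joins L U (spec_closure L U S) \<subseteq> spec_closure L U S"
    unfolding spec_joins_def by blast
  moreover have "?Q (spec_closure L U S)"
    unfolding spec_closure_def
    using r(1) Q0 QF QU by (rule iter_upto_induct[where Q = ?Q])
  ultimately show ?thesis
    unfolding join_ideal_def by blast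
qed

lemma (in partial_order) subset_spec_closure:
  assumes "S \<subseteq> carrier L"
  shows "S \<subseteq> spec_closure L U S"
proof -
  have "down_closure L S \<subseteq> spec_closure L U S"
    unfolding spec_closure_def by (rule base_subset_iter_upto[OF Cinfinite_reg_above_radius])
  with subset_down_closure[OF assms] show ?thesis by (rule subset_trans)
qed

lemma (in partial_order) closed_sets_spec_closure:
  assumes "join_specification L U"
  shows "closed_sets L (spec_closure L U) = Collect (join_ideal L U)"
proof (intro subset_antisym subsetI)
  fix C assume "C \<in> closed_sets L (spec_closure L U)"
  then show "C \<in> Collect (join_ideal L U)"
    using join_ideal_spec_closure[OF assms, of C] by (simp add: closed_sets_def)
next
  fix C assume "C \<in> Collect (join_ideal L U)"
  then have C: "join_ideal L U C" by simp
  then have "C \<subseteq> carrier L" by (simp add: join_ideal_def)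
  then show "C \<in> closed_sets L (spec_closure L U)"
    using subset_spec_closure[of C U] spec_closure_subset_ideal[OF C subset_refl]
    by (simp add: closed_sets_def subset_antisym)
qed

text \<open>
  The join of a set lies below each of its upper bounds, here \<open>p\<close>. Because of this lemma the closure
  operator is standard.
\<close>

lemma (in partial_order) join_ideal_principal:
  assumes U: "join_specification L U" and p: "p \<in> carrier L"
  shows "join_ideal L U (down_closure L {p})"
proof -
  have "\<Squnion>T \<in> down_closure L {p}" if T: "T \<in> U" "T \<subseteq> down_closure L {p}" for T
  proof -
    have lub: "is_lub L (\<Squnion>T) T"
      using U T(1) join_exists_is_lub[of L T] by (simp add: join_specification_def)
    have "x \<sqsubseteq> p" if "x \<in> T" for x
      using that T(2) by (auto simp: down_closure_def)
    then have "p \<in> Upper L T"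
      using p by (rule Upper_memI)
    then show ?thesis
      using least_le[OF lub] least_closed[OF lub] by (simp add: down_closure_def)
  qed
  then have "spec_joins L U (down_closure L {p}) \<subseteq> down_closure L {p}"
    unfolding spec_joins_def by blast
  moreover have "down_closure L (down_closure L {p}) \<subseteq> down_closure L {p}"
    by (rule down_closure_idem) (simp add: p)
  moreover have "down_closure L {p} \<subseteq> carrier L"
    by (auto simp: down_closure_def)
  ultimately show ?thesis
    unfolding join_ideal_def by blast
qed


section \<open>Lattices of closed sets\<close>

locale closure_on =
  fixes P :: "('a, 'm) gorder_scheme" and \<Gamma> :: "'a set \<Rightarrow> 'a set"
  assumes in_carrier: "S \<subseteq> carrier P \<Longrightarrow> \<Gamma> S \<subseteq> carrier P"
    and extensive: "S \<subseteq> carrier P \<Longrightarrow> S \<subseteq> \<Gamma> S"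
    and mono: "S \<subseteq> T \<Longrightarrow> T \<subseteq> carrier P \<Longrightarrow> \<Gamma> S \<subseteq> \<Gamma> T"
    and idem: "S \<subseteq> carrier P \<Longrightarrow> \<Gamma> (\<Gamma> S) = \<Gamma> S"
begin

abbreviation "K \<equiv> closed_sets P \<Gamma>"
abbreviation "L \<equiv> closed_order P \<Gamma>"

lemma carrier_closed: "carrier L = K"
  by (simp add: closed_order_def)

lemma closedD: "C \<in> K \<Longrightarrow> C \<subseteq> carrier P" "C \<in> K \<Longrightarrow> \<Gamma> C = C"
  by (auto simp: closed_sets_def)

lemma closure_closed: "S \<subseteq> carrier P \<Longrightarrow> \<Gamma> S \<in> K"
  using idem in_carrier by (simp add: closed_sets_def)

lemma closure_least: "S \<subseteq> C \<Longrightarrow> C \<in> K \<Longrightarrow> \<Gamma> S \<subseteq> C"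
  using mono[of S C] closedD[of C] by simp

text \<open>Intersecting with the carrier gives the empty family its meet, the top element.\<close>

lemma closed_Inter:
  assumes "Y \<subseteq> K"
  shows "carrier P \<inter> \<Inter>Y \<in> K"
proof -
  have "\<Gamma> (carrier P \<inter> \<Inter>Y) \<subseteq> C" if "C \<in> Y" for C
    by (rule closure_least) (use that assms in auto)
  then have "\<Gamma> (carrier P \<inter> \<Inter>Y) \<subseteq> carrier P \<inter> \<Inter>Y"
    using in_carrier[of "carrier P \<inter> \<Inter>Y"] by blast
  then show ?thesis
    using extensive[of "carrier P \<inter> \<Inter>Y"] by (auto simp: closed_sets_def)
qed

lemma carrier_Int_closed: "C \<in> K \<Longrightarrow> carrier P \<inter> \<Inter>{C, D} = C \<inter> D"
  using closedD(1) by auto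

lemma closed_Int: "C \<in> K \<Longrightarrow> D \<in> K \<Longrightarrow> C \<inter> D \<in> K"
  using closed_Inter[of "{C, D}"] by (simp only: carrier_Int_closed) simp

lemma partial_order_closed: "partial_order L"
  by unfold_locales (auto simp: closed_order_def)

lemma is_lub_closed:
  assumes "Y \<subseteq> K"
  shows "is_lub L (\<Gamma> (\<Union>Y)) Y"
proof -
  have Un: "\<Union>Y \<subseteq> carrier P"
    using assms closedD(1) by blast
  have "\<Gamma> (\<Union>Y) \<subseteq> C" if "C \<in> K" "\<forall>D\<in>Y. D \<subseteq> C" for C
    by (rule closure_least) (use that in auto)
  moreover have "\<forall>D\<in>Y. D \<subseteq> \<Gamma> (\<Union>Y)"
    using extensive[OF Un] by auto
  ultimately show ?thesis
    using assms closure_closed[OF Un]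
    by (intro least_UpperI) (auto simp: closed_order_def Upper_def Int_absorb2)
qed

lemma is_glb_closed:
  assumes "Y \<subseteq> K"
  shows "is_glb L (carrier P \<inter> \<Inter>Y) Y"
proof (rule greatest_LowerI)
  fix C assume "C \<in> Lower L Y"
  then have "C \<in> K" "\<forall>D\<in>Y. C \<subseteq> D"
    using assms by (auto simp: closed_order_def Lower_def)
  then show "C \<sqsubseteq>\<^bsub>L\<^esub> carrier P \<inter> \<Inter>Y"
    using closedD(1)[of C] by (auto simp: closed_order_def)
qed (use assms closed_Inter[OF assms] in \<open>auto simp: closed_order_def\<close>)

lemma complete_lattice_closed: "complete_lattice L"
proof -
  interpret partial_order L by (rule partial_order_closed)
  show ?thesis
    by (rule complete_latticeI)
      (use is_lub_closed is_glb_closed in \<open>auto simp: closed_order_def\<close>)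
qed

lemma sup_closed: "Y \<subseteq> K \<Longrightarrow> \<Squnion>\<^bsub>L\<^esub>Y = \<Gamma> (\<Union>Y)"
  using partial_order.is_lub_imp_sup_eq[OF partial_order_closed] is_lub_closed by blast

lemma meet_closed:
  assumes "C \<in> K" "D \<in> K"
  shows "C \<sqinter>\<^bsub>L\<^esub> D = C \<inter> D"
proof -
  have glb: "is_glb L (C \<inter> D) {C, D}"
    using is_glb_closed[of "{C, D}"] assms by (simp only: carrier_Int_closed) simp
  then have "is_glb L (C \<sqinter>\<^bsub>L\<^esub> D) {C, D}"
    unfolding meet_def inf_def by (rule someI)
  from partial_order.greatest_unique[OF partial_order_closed this glb] show ?thesis .
qed

text \<open>The opposite inclusion holds in every complete lattice.\<close>

lemma frame_iff:
  "frame L \<longleftrightarrow> (\<forall>C\<in>K. \<forall>Y\<subseteq>K. C \<inter> \<Gamma> (\<Union>Y) \<subseteq> \<Gamma> (\<Union>D\<in>Y. C \<inter> D))"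
proof
  assume "frame L"
  \<comment> \<open>This successor cardinal exceeds the size of every family of subsets.\<close>
  then have dist: "alpha_distributive L (cardSuc |UNIV :: 'a set set| )"
    by (rule frame_alpha_distributive)
  show "\<forall>C\<in>K. \<forall>Y\<subseteq>K. C \<inter> \<Gamma> (\<Union>Y) \<subseteq> \<Gamma> (\<Union>D\<in>Y. C \<inter> D)"
  proof (intro ballI allI impI)
    fix C Y assume C: "C \<in> K" and Y: "Y \<subseteq> K"
    have small: "|Y| <o cardSuc |UNIV :: 'a set set|"
      using card_of_mono1[OF subset_UNIV] cardSuc_greater[OF card_of_Card_order]
        ordLeq_ordLess_trans by blast
    have meets: "(\<lambda>D. C \<sqinter>\<^bsub>L\<^esub> D) ` Y = (\<inter>) C ` Y"
      using C Y meet_closed by (intro image_cong) auto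
    have sup: "\<Gamma> (\<Union>Y) \<in> K"
      by (rule closure_closed) (use Y closedD(1) in blast)
    have "join_exists L Y"
      using is_lub_closed[OF Y] unfolding join_exists_def by (rule exI)
    with dist C Y small
    have "is_lub L (C \<sqinter>\<^bsub>L\<^esub> \<Squnion>\<^bsub>L\<^esub>Y) ((\<lambda>D. C \<sqinter>\<^bsub>L\<^esub> D) ` Y)"
      unfolding alpha_distributive_def carrier_closed by blast
    then have lub: "is_lub L (C \<inter> \<Gamma> (\<Union>Y)) ((\<inter>) C ` Y)"
      unfolding meets sup_closed[OF Y] meet_closed[OF C sup] .
    have "(\<inter>) C ` Y \<subseteq> K"
      using C Y closed_Int by blast
    from partial_order.least_unique[OF partial_order_closed lub is_lub_closed[OF this]]
    show "C \<inter> \<Gamma> (\<Union>Y) \<subseteq> \<Gamma> (\<Union>D\<in>Y. C \<inter> D)" by simp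
  qed
next
  assume dist: "\<forall>C\<in>K. \<forall>Y\<subseteq>K. C \<inter> \<Gamma> (\<Union>Y) \<subseteq> \<Gamma> (\<Union>D\<in>Y. C \<inter> D)"
  have "is_lub L (C \<sqinter>\<^bsub>L\<^esub> \<Squnion>\<^bsub>L\<^esub>Y) ((\<lambda>D. C \<sqinter>\<^bsub>L\<^esub> D) ` Y)" if C: "C \<in> K" and Y: "Y \<subseteq> K" for C Y
  proof -
    have Un: "\<Union>Y \<subseteq> carrier P"
      using Y closedD(1) by blast
    have meets: "(\<lambda>D. C \<sqinter>\<^bsub>L\<^esub> D) ` Y = (\<inter>) C ` Y"
      using C Y meet_closed by (intro image_cong) auto
    have "\<Gamma> (\<Union>D\<in>Y. C \<inter> D) \<subseteq> C \<inter> \<Gamma> (\<Union>Y)"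
      by (rule closure_least) (use extensive[OF Un] closed_Int[OF C closure_closed[OF Un]] in auto)
    moreover have "C \<inter> \<Gamma> (\<Union>Y) \<subseteq> \<Gamma> (\<Union>D\<in>Y. C \<inter> D)"
      using dist C Y by blast
    ultimately have "C \<sqinter>\<^bsub>L\<^esub> \<Squnion>\<^bsub>L\<^esub>Y = \<Gamma> (\<Union>((\<inter>) C ` Y))"
      unfolding sup_closed[OF Y] meet_closed[OF C closure_closed[OF Un]]
      by (rule subset_antisym[rotated])
    moreover have "is_lub L (\<Gamma> (\<Union>((\<inter>) C ` Y))) ((\<inter>) C ` Y)"
      by (rule is_lub_closed) (use C Y closed_Int in blast)
    ultimately show ?thesis
      by (simp only: meets)
  qed
  then show "frame L"
    unfolding frame_def alpha_distributive_def carrier_closed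
    using complete_lattice_closed complete_lattice_lattice by blast
qed

end

lemma (in partial_order) closure_on_spec_closure:
  assumes "join_specification L U"
  shows "closure_on L (spec_closure L U)"
proof
  fix S assume S: "S \<subseteq> carrier L"
  note ideal = join_ideal_spec_closure[OF assms S]
  show "spec_closure L U S \<subseteq> carrier L"
    using ideal by (simp add: join_ideal_def)
  show "S \<subseteq> spec_closure L U S"
    by (rule subset_spec_closure[OF S])
  show "spec_closure L U (spec_closure L U S) = spec_closure L U S"
    using ideal closed_sets_spec_closure[OF assms] by (auto simp: closed_sets_def)
next
  fix S T assume "S \<subseteq> T" "T \<subseteq> carrier L"
  then show "spec_closure L U S \<subseteq> spec_closure L U T"
    using spec_closure_subset_ideal[OF join_ideal_spec_closure[OF assms]] subset_spec_closure
    by blast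
qed


section \<open>Frames and the operator \<open>\<Upsilon>\<close>\<close>

context partial_order
begin

text \<open>
  A join in the down-set \<open>C\<close> is a join of elements of \<open>C\<close>, so the part of a stage inside \<open>C\<close> is obtained
  by joins from the part of the previous stage inside \<open>C\<close>. A downward closure after each step would
  break this: a point of \<open>C\<close> below a join need not be the join of points of \<open>C\<close>.
\<close>

lemma join_iteration_Int_ideal_subset:
  assumes V: "join_specification L V" and C: "join_ideal L V C"
  shows "join_iteration L (spec_closure L V) S \<inter> C \<subseteq>
         spec_closure L V (down_closure L S \<inter> C)"
proof -
  let ?\<Phi> = "spec_closure L V"
  let ?W = "closure_spec L ?\<Phi>"
  let ?D = "?\<Phi> (down_closure L S \<inter> C)"
  have sub: "down_closure L S \<inter> C \<subseteq> carrier L"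
    by (auto simp: down_closure_def)
  have D: "?D \<in> closed_sets L ?\<Phi>"
    using join_ideal_spec_closure[OF V sub] closed_sets_spec_closure[OF V] by simp
  show ?thesis
    unfolding join_iteration_def
  proof (rule iter_upto_induct[where Q = "\<lambda>X. X \<inter> C \<subseteq> ?D"])
    show "Cinfinite (reg_above (radius ?W))"
      by (rule Cinfinite_reg_above_radius)
    show "down_closure L S \<inter> C \<subseteq> ?D"
      by (rule subset_spec_closure[OF sub])
  next
    fix X assume IH: "X \<inter> C \<subseteq> ?D"
    show "spec_joins L ?W X \<inter> C \<subseteq> ?D"
    proof
      fix p assume "p \<in> spec_joins L ?W X \<inter> C"
      then obtain T where T: "T \<in> ?W" "T \<subseteq> X" and p: "p = \<Squnion>T" "p \<in> C"
        by (auto simp: spec_joins_def)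
      have "T \<subseteq> carrier L" "is_lub L p T"
        using T(1) p(1) join_exists_is_lub[of L T] by (auto simp: closure_spec_def)
      then have "T \<subseteq> down_closure L {p}"
        using least_Upper_above[of L p T] by (auto simp: down_closure_def)
      then have "T \<subseteq> C"
        using C p(2) by (auto simp: join_ideal_def down_closure_def)
      with IH T(2) have "T \<subseteq> ?D" by blast
      with T(1) D p(1) show "p \<in> ?D"
        by (auto simp: closure_spec_def)
    qed
  qed blast
qed

lemma join_iteration_subset_spec_closure:
  assumes V: "join_specification L V" and S: "S \<subseteq> carrier L"
  shows "join_iteration L (spec_closure L V) S \<subseteq> spec_closure L V S"
proof -
  let ?\<Phi> = "spec_closure L V"
  let ?W = "closure_spec L ?\<Phi>"
  have ideal: "join_ideal L V (?\<Phi> S)"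
    by (rule join_ideal_spec_closure[OF V S])
  then have closed: "?\<Phi> S \<in> closed_sets L ?\<Phi>"
    using closed_sets_spec_closure[OF V] by simp
  show ?thesis
    unfolding join_iteration_def
  proof (rule iter_upto_induct[where Q = "\<lambda>X. X \<subseteq> ?\<Phi> S"])
    show "Cinfinite (reg_above (radius ?W))"
      by (rule Cinfinite_reg_above_radius)
    show "down_closure L S \<subseteq> ?\<Phi> S"
      using ideal subset_spec_closure[OF S, of V] by (auto simp: join_ideal_def down_closure_def)
    show "spec_joins L ?W X \<subseteq> ?\<Phi> S" if "X \<subseteq> ?\<Phi> S" for X
      using that closed by (auto simp: spec_joins_def closure_spec_def)
  qed blast
qed

text \<open>
  An upper bound \<open>q\<close> of \<open>T\<close> gives a closed set, the principal down-set of \<open>q\<close>, that includes \<open>T\<close> and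
  therefore contains \<open>p\<close>; and a closed set that includes \<open>T\<close> includes all of its closure.
\<close>

lemma join_of_generating_set:
  assumes V: "join_specification L V" and p: "p \<in> carrier L"
    and T: "T \<subseteq> down_closure L {p}" "p \<in> spec_closure L V T"
  shows "T \<in> closure_spec L (spec_closure L V)" "\<Squnion>T = p"
proof -
  have TL: "T \<subseteq> carrier L"
    using T(1) by (auto simp: down_closure_def)
  have lub: "is_lub L p T"
  proof (rule least_UpperI)
    fix q assume "q \<in> Upper L T"
    then have q: "q \<in> carrier L" "T \<subseteq> down_closure L {q}"
      using TL by (auto simp: Upper_def down_closure_def)
    then have "spec_closure L V T \<subseteq> down_closure L {q}"
      by (intro spec_closure_subset_ideal join_ideal_principal V)
    with T(2) show "p \<sqsubseteq> q"
      by (auto simp: down_closure_def)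
  qed (use T(1) TL p in \<open>auto simp: down_closure_def\<close>)
  then show eq: "\<Squnion>T = p"
    by (rule is_lub_imp_sup_eq)
  have "p \<in> C" if "C \<in> closed_sets L (spec_closure L V)" "T \<subseteq> C" for C
    using that closed_sets_spec_closure[OF V] spec_closure_subset_ideal T(2) by blast
  with TL lub eq show "T \<in> closure_spec L (spec_closure L V)"
    by (auto simp: closure_spec_def join_exists_def)
qed

lemma spec_closure_eq_join_iteration_iff_frame:
  assumes V: "join_specification L V"
  shows "(\<forall>S\<in>Pow (carrier L). spec_closure L V S = join_iteration L (spec_closure L V) S) \<longleftrightarrow>
         frame (closed_order L (spec_closure L V))"
proof -
  interpret \<Phi>: closure_on L "spec_closure L V"
    by (rule closure_on_spec_closure[OF V])
  let ?\<Phi> = "spec_closure L V"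
  let ?\<Upsilon> = "join_iteration L ?\<Phi>"
  note closed_eq = closed_sets_spec_closure[OF V]
  show ?thesis
  proof
    assume eq: "\<forall>S\<in>Pow (carrier L). ?\<Phi> S = ?\<Upsilon> S"
    show "frame (closed_order L ?\<Phi>)"
      unfolding \<Phi>.frame_iff
    proof (intro ballI allI impI)
      fix C Y assume C: "C \<in> \<Phi>.K" and Y: "Y \<subseteq> \<Phi>.K"
      have ideals: "D \<subseteq> carrier L \<and> down_closure L D \<subseteq> D" if "D \<in> Y" for D
        using subsetD[OF Y that] by (simp add: closed_eq join_ideal_def)
      then have YL: "\<Union>Y \<subseteq> carrier L" by blast
      have "down_closure L (\<Union>Y) = (\<Union>D\<in>Y. down_closure L D)"
        by (auto simp: down_closure_def)
      with ideals have Ydown: "down_closure L (\<Union>Y) \<subseteq> \<Union>Y" by blast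
      have "down_closure L (\<Union>Y) \<inter> C = (\<Union>D\<in>Y. C \<inter> D)"
        using Ydown subset_down_closure[OF YL] by blast
      moreover have "?\<Upsilon> (\<Union>Y) \<inter> C \<subseteq> ?\<Phi> (down_closure L (\<Union>Y) \<inter> C)"
        using C closed_eq by (intro join_iteration_Int_ideal_subset V) simp
      moreover have "?\<Phi> (\<Union>Y) = ?\<Upsilon> (\<Union>Y)"
        using eq YL by simp
      ultimately show "C \<inter> ?\<Phi> (\<Union>Y) \<subseteq> ?\<Phi> (\<Union>D\<in>Y. C \<inter> D)"
        by (simp add: Int_commute)
    qed
  next
    assume frame: "frame (closed_order L ?\<Phi>)"
    show "\<forall>S\<in>Pow (carrier L). ?\<Phi> S = ?\<Upsilon> S"
    proof
      fix S assume "S \<in> Pow (carrier L)"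
      then have S: "S \<subseteq> carrier L" by simp
      have "?\<Phi> S \<subseteq> ?\<Upsilon> S"
      proof
        fix p assume p: "p \<in> ?\<Phi> S"
        then have pL: "p \<in> carrier L"
          using \<Phi>.in_carrier[OF S] by blast
        \<comment> \<open>The closure of \<open>S\<close> is the join of the principal down-sets in \<open>?Y\<close>, and the frame law
          distributes the principal down-set of \<open>p\<close> over it; \<open>?T\<close> is the union on the other side.\<close>
        let ?Y = "(\<lambda>s. down_closure L {s}) ` S"
        let ?T = "\<Union>D\<in>?Y. down_closure L {p} \<inter> D"
        have K: "down_closure L {q} \<in> \<Phi>.K" if "q \<in> carrier L" for q
          using join_ideal_principal[OF V that] closed_eq by simp
        have Un: "\<Union>?Y = down_closure L S"
          by (auto simp: down_closure_def)
        have "p \<in> ?\<Phi> (\<Union>?Y)"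
          using p \<Phi>.mono[OF subset_down_closure[OF S]] unfolding Un
          by (auto simp: down_closure_def)
        moreover have "p \<in> down_closure L {p}"
          using pL by (simp add: down_closure_def)
        moreover have "?Y \<subseteq> \<Phi>.K"
          using K S by blast
        ultimately have gen: "p \<in> ?\<Phi> ?T"
          using frame K[OF pL] unfolding \<Phi>.frame_iff by blast
        have "?T \<subseteq> down_closure L {p}" by blast
        note join_of_generating_set[OF V pL this gen]
        moreover have "?T \<subseteq> down_closure L S"
          using Un by blast
        ultimately have "p \<in> spec_joins L (closure_spec L ?\<Phi>) (down_closure L S)"
          unfolding spec_joins_def by (intro CollectI exI[of _ ?T]) simp
        moreover have "Cinfinite (reg_above (radius (closure_spec L ?\<Phi>)))"
          by (rule Cinfinite_reg_above_radius)
        ultimately show "p \<in> ?\<Upsilon> S"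
          unfolding join_iteration_def by (intro subsetD[OF step_base_subset_iter_upto])
      qed
      with join_iteration_subset_spec_closure[OF V S] show "?\<Phi> S = ?\<Upsilon> S" by blast
    qed
  qed
qed

end

theorem theorem3p5:
  fixes P :: "('a, 'm) gorder_scheme" and V :: "'a set set"
  assumes "partial_order P"
    and "minimal_join_specification P V"
  shows "(\<forall>S\<in>Pow (carrier P). spec_closure P V S = join_iteration P (spec_closure P V) S) \<longleftrightarrow>
         frame (closed_order P (spec_closure P V))"
  using partial_order.spec_closure_eq_join_iteration_iff_frame[OF assms(1)] assms(2)
  by (simp add: minimal_join_specification_def)

end
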